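(* Let $V$ be a finite-dimensional $\mathbb{K}$-vector space, $\mathbb{K}\in\{\mathbb{R},\mathbb{C}\}$. Consider the following problem: find generators of the vector space of algebraic curvature tensors $\mathfrak R\in\mathcal T_4V$, or of the vector space of algebraic covariant derivative curvature tensors $\mathfrak R'\in\mathcal T_5V$, which can be formed by a suitable symmetry operator from tensors of the type - for $\mathfrak R$: $U\otimes w$, with $U\in\mathcal T_3V$, $w\in\mathcal T_1V$; - for $\mathfrak R'$: $U\otimes W$, with $U\in\mathcal T_3V$, $W\in\mathcal T_2V$, where $W$ and $U$ belong to symmetry classes of $\mathcal T_2V$ and $\mathcal T_3V$ which are defined by minimal right ideals $\mathfrak r\subset\mathbb{K}[\mathcal S_2]$ and $\hat{\mathfrak r}\subset\mathbb{K}[\mathcal S_3]$, respectively. A solution of this problem can be constructed at most from such products $U\otimes w$ or $U\otimes W$ whose factors belong to symmetry classes belonging to the following partitions: For $\mathfrak R$, products $U\otimes w$: (a) $U\to(2\,1)$. For $\mathfrak R'$, products $U\otimes W$: (a') $U\to(3)$, $W\to(2)$ (that is, $U$ and $W$ are symmetric); (b') $U\to(2\,1)$, $W\to(2)$ (that is, $W$ is symmetric); (c') $U\to(2\,1)$, $W\to(1^2)$ (that is, $W$ is skew-symmetric).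
   Context: $\mathcal T_rV$ is the $\mathbb{K}$-vector space of covariant tensors of order $r$ over $V$. An algebraic curvature tensor is a tensor $\mathfrak R\in\mathcal T_4V$ whose coordinates satisfy $\mathfrak R_{ijkl}=-\mathfrak R_{jikl}=\mathfrak R_{klij}$ and $\mathfrak R_{ijkl}+\mathfrak R_{iklj}+\mathfrak R_{iljk}=0$. An algebraic covariant derivative curvature tensor is a tensor $\mathfrak R'\in\mathcal T_5V$ whose coordinates satisfy $\mathfrak R'_{ijklm}=-\mathfrak R'_{jiklm}=\mathfrak R'_{klijm}$, $\mathfrak R'_{ijklm}+\mathfrak R'_{ikljm}+\mathfrak R'_{iljkm}=0$ and $\mathfrak R'_{ijklm}+\mathfrak R'_{ijlmk}+\mathfrak R'_{ijmkl}=0$. $\mathcal S_r$ is the symmetric group and $\mathbb{K}[\mathcal S_r]$ its group ring. An element $a=\sum_{p\in\mathcal S_r}a(p)\,p\in\mathbb{K}[\mathcal S_r]$ is regarded as a symmetry operator acting on $T\in\mathcal T_rV$ by $(aT)(v_1,\dots,v_r)=\sum_{p\in\mathcal S_r}a(p)\,T(v_{p(1)},\dots,v_{p(r)})$. If $\mathfrak r\subseteq\mathbb{K}[\mathcal S_r]$ is a right ideal for which some $a\in\mathfrak r$ and $T\in\mathcal T_rV$ exist with $aT\neq0$, the symmetry class defined by $\mathfrak r$ is the set $\mathcal T_{\mathfrak r}=\{aT\mid a\in\mathfrak r,\ T\in\mathcal T_rV\}$. For a Young tableau $t$ with $r$ boxes, the Young symmetrizer is $y_t=\sum_{p\in\mathcal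 H_t}\sum_{q\in\mathcal V_t}\mathrm{sign}(q)\,p\circ q$, where $\mathcal H_t$ and $\mathcal V_t$ are the groups of permutations which only permute numbers within rows, respectively columns, of $t$. For a partition $\lambda\vdash r$, $\mathfrak a_\lambda=\bigoplus_t \mathbb{K}[\mathcal S_r]\cdot y_t=\bigoplus_t y_t\cdot\mathbb{K}[\mathcal S_r]$ (sums over all standard tableaux $t$ of shape $\lambda$) is the corresponding minimal two-sided ideal of $\mathbb{K}[\mathcal S_r]$. A symmetry class $\mathcal T_{\mathfrak r}$ is said to belong to $\lambda\vdash r$ iff $\mathfrak r\subseteq\mathfrak a_\lambda$; the notation $U\to\lambda$ means that the symmetry class of $U$ belongs to $\lambda$ (similarly for $W$). *)

theory Defs
  imports Complex_Main "HOL-Library.Function_Algebras" "HOL-Combinatorics.Permutations"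
begin

text \<open>
  The ground field ranges over the type class \<open>real_normed_field\<close>: by the Gelfand-Mazur theorem its
  instances are, up to isomorphism, exactly the real and the complex numbers.

  Positions are counted from 0: \<open>S\<^sub>r\<close> is the group of permutations of \<open>{..<r}\<close>, and tableaux with
  \<open>r\<close> boxes are filled with the numbers \<open>0, ..., r - 1\<close>.
\<close>

text \<open>
  A tensor of order \<open>r\<close> is a multilinear form on argument lists of length \<open>r\<close>, set to 0 on all other
  lists, so that equality of tensors is equality of functions.
\<close>

definition tensors ::
  "('k::field \<Rightarrow> 'v::ab_group_add \<Rightarrow> 'v) \<Rightarrow> nat \<Rightarrow> ('v list \<Rightarrow> 'k) set" where
  "tensors scale r =
     {T. (\<forall>vs. length vs \<noteq> r \<longrightarrow> T vs = 0) \<and>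
         (\<forall>vs i. length vs = r \<longrightarrow> i < r \<longrightarrow>
            Vector_Spaces.linear scale (*) (\<lambda>x. T (vs[i := x])))}"

definition tensor_prod ::
  "nat \<Rightarrow> ('v list \<Rightarrow> 'k::field) \<Rightarrow> ('v list \<Rightarrow> 'k) \<Rightarrow> 'v list \<Rightarrow> 'k" where
  "tensor_prod r U W vs = U (take r vs) * W (drop r vs)"

abbreviation tensor_span :: "('v list \<Rightarrow> 'k::field) set \<Rightarrow> ('v list \<Rightarrow> 'k) set" where
  "tensor_span \<equiv> module.span (\<lambda>c T vs. c * T vs)"

definition symmetric_tensor :: "nat \<Rightarrow> ('v list \<Rightarrow> 'k::field) \<Rightarrow> bool" where
  "symmetric_tensor r T \<longleftrightarrow>
     (\<forall>p vs. p permutes {..<r} \<longrightarrow> length vs = r \<longrightarrow> T (permute_list p vs) = T vs)"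

definition skew_tensor :: "nat \<Rightarrow> ('v list \<Rightarrow> 'k::field) \<Rightarrow> bool" where
  "skew_tensor r T \<longleftrightarrow>
     (\<forall>p vs. p permutes {..<r} \<longrightarrow> length vs = r \<longrightarrow>
        T (permute_list p vs) = of_int (sign p) * T vs)"

text \<open>
  The index identities of the coordinates are read as identities for all arguments, which makes them
  independent of a basis.
\<close>

definition curvature_tensors ::
  "('k::field \<Rightarrow> 'v::ab_group_add \<Rightarrow> 'v) \<Rightarrow> ('v list \<Rightarrow> 'k) set" where
  "curvature_tensors scale =
     {R \<in> tensors scale 4. \<forall>i j k l.
        R [i, j, k, l] = - R [j, i, k, l] \<and>
        R [i, j, k, l] = R [k, l, i, j] \<and>
        R [i, j, k, l] + R [i, k, l, j] + R [i, l, j, k] = 0}"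

definition covariant_derivative_curvature_tensors ::
  "('k::field \<Rightarrow> 'v::ab_group_add \<Rightarrow> 'v) \<Rightarrow> ('v list \<Rightarrow> 'k) set" where
  "covariant_derivative_curvature_tensors scale =
     {R \<in> tensors scale 5. \<forall>i j k l m.
        R [i, j, k, l, m] = - R [j, i, k, l, m] \<and>
        R [i, j, k, l, m] = R [k, l, i, j, m] \<and>
        R [i, j, k, l, m] + R [i, k, l, j, m] + R [i, l, j, k, m] = 0 \<and>
        R [i, j, k, l, m] + R [i, j, l, m, k] + R [i, j, m, k, l] = 0}"

definition group_ring :: "nat \<Rightarrow> ((nat \<Rightarrow> nat) \<Rightarrow> 'k::field) set" where
  "group_ring r = {a. \<forall>p. \<not> p permutes {..<r} \<longrightarrow> a p = 0}"

definition gr_mult ::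
  "nat \<Rightarrow> ((nat \<Rightarrow> nat) \<Rightarrow> 'k::field) \<Rightarrow> ((nat \<Rightarrow> nat) \<Rightarrow> 'k) \<Rightarrow> (nat \<Rightarrow> nat) \<Rightarrow> 'k" where
  "gr_mult r a b =
     (\<lambda>s. \<Sum>p | p permutes {..<r}. \<Sum>q | q permutes {..<r}. if p \<circ> q = s then a p * b q else 0)"

text \<open>Entry \<open>i\<close> of \<open>permute_list p vs\<close> is \<open>vs ! p i\<close>, so \<open>p\<close> acts on the argument positions.\<close>

definition sym_op ::
  "nat \<Rightarrow> ((nat \<Rightarrow> nat) \<Rightarrow> 'k::field) \<Rightarrow> ('v list \<Rightarrow> 'k) \<Rightarrow> 'v list \<Rightarrow> 'k" where
  "sym_op r a T = (\<lambda>vs. \<Sum>p | p permutes {..<r}. a p * T (permute_list p vs))"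

definition right_ideal :: "nat \<Rightarrow> ((nat \<Rightarrow> nat) \<Rightarrow> 'k::field) set \<Rightarrow> bool" where
  "right_ideal r I \<longleftrightarrow>
     I \<subseteq> group_ring r \<and> 0 \<in> I \<and> (\<forall>a\<in>I. \<forall>b\<in>I. a + b \<in> I) \<and>
     (\<forall>a\<in>I. \<forall>b\<in>group_ring r. gr_mult r a b \<in> I)"

definition minimal_right_ideal :: "nat \<Rightarrow> ((nat \<Rightarrow> nat) \<Rightarrow> 'k::field) set \<Rightarrow> bool" where
  "minimal_right_ideal r I \<longleftrightarrow>
     right_ideal r I \<and> I \<noteq> {0} \<and> (\<forall>J. right_ideal r J \<and> J \<subseteq> I \<longrightarrow> J = {0} \<or> J = I)"

definition defines_symmetry_class ::
  "('k::field \<Rightarrow> 'v::ab_group_add \<Rightarrow> 'v) \<Rightarrow> nat \<Rightarrow> ((nat \<Rightarrow> nat) \<Rightarrow> 'k) set \<Rightarrow> bool" where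
  "defines_symmetry_class scale r I \<longleftrightarrow>
     right_ideal r I \<and> (\<exists>a\<in>I. \<exists>T\<in>tensors scale r. sym_op r a T \<noteq> 0)"

definition symmetry_class ::
  "('k::field \<Rightarrow> 'v::ab_group_add \<Rightarrow> 'v) \<Rightarrow> nat \<Rightarrow> ((nat \<Rightarrow> nat) \<Rightarrow> 'k) set \<Rightarrow> ('v list \<Rightarrow> 'k) set" where
  "symmetry_class scale r I = {sym_op r a T | a T. a \<in> I \<and> T \<in> tensors scale r}"

text \<open>A tableau is the list of its rows, a partition the (weakly decreasing) list of its parts.\<close>

definition standard_tableau :: "nat list \<Rightarrow> nat list list \<Rightarrow> bool" where
  "standard_tableau \<mu> t \<longleftrightarrow>
     map length t = \<mu> \<and> distinct (concat t) \<and> set (concat t) = {..<sum_list \<mu>} \<and>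
     (\<forall>row\<in>set t. sorted_wrt (<) row) \<and>
     (\<forall>i j. Suc i < length t \<and> j < length (t ! Suc i) \<longrightarrow> t ! i ! j < t ! Suc i ! j)"

definition column :: "nat list list \<Rightarrow> nat \<Rightarrow> nat set" where
  "column t j = {t ! i ! j | i. i < length t \<and> j < length (t ! i)}"

definition row_group :: "nat list list \<Rightarrow> (nat \<Rightarrow> nat) set" where
  "row_group t = {p. p permutes set (concat t) \<and> (\<forall>row\<in>set t. p ` set row = set row)}"

definition column_group :: "nat list list \<Rightarrow> (nat \<Rightarrow> nat) set" where
  "column_group t = {q. q permutes set (concat t) \<and> (\<forall>j. q ` column t j = column t j)}"

definition young_symmetrizer :: "nat list list \<Rightarrow> (nat \<Rightarrow> nat) \<Rightarrow> 'k::field" where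
  "young_symmetrizer t =
     (\<lambda>s. \<Sum>p\<in>row_group t. \<Sum>q\<in>column_group t. if p \<circ> q = s then of_int (sign q) else 0)"

definition young_ideal :: "nat list \<Rightarrow> ((nat \<Rightarrow> nat) \<Rightarrow> 'k::field) set" where
  "young_ideal \<mu> =
     {(\<Sum>t | standard_tableau \<mu> t. gr_mult (sum_list \<mu>) (b t) (young_symmetrizer t)) | b.
        \<forall>t. b t \<in> group_ring (sum_list \<mu>)}"

definition belongs_to :: "((nat \<Rightarrow> nat) \<Rightarrow> 'k::field) set \<Rightarrow> nat list \<Rightarrow> bool" where
  "belongs_to I \<mu> \<longleftrightarrow> I \<subseteq> young_ideal \<mu>"

text \<open>
  A solution is a set of (nonzero) generators of the whole space together with the way each of them
  is formed: the symmetry operator, the minimal right ideals of the symmetry classes, and the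
  factors. A fixed operator and fixed symmetry classes are the special case where these components
  are constant. A vanishing product generates nothing, and admitting it would admit arbitrary
  symmetry classes by means of the zero operator; hence the generators are required to be nonzero.
\<close>

definition curvature_solution ::
  "('k::field \<Rightarrow> 'v::ab_group_add \<Rightarrow> 'v) \<Rightarrow>
   (((nat \<Rightarrow> nat) \<Rightarrow> 'k) \<times> ((nat \<Rightarrow> nat) \<Rightarrow> 'k) set \<times> ('v list \<Rightarrow> 'k) \<times> ('v list \<Rightarrow> 'k)) set \<Rightarrow> bool"
where
  "curvature_solution scale X \<longleftrightarrow>
     (\<forall>(a, I, U, w)\<in>X.
        a \<in> group_ring 4 \<and>
        minimal_right_ideal 3 I \<and> defines_symmetry_class scale 3 I \<and>
        U \<in> symmetry_class scale 3 I \<and> w \<in> tensors scale 1 \<and>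
        sym_op 4 a (tensor_prod 3 U w) \<noteq> 0) \<and>
     tensor_span {sym_op 4 a (tensor_prod 3 U w) | a I U w. (a, I, U, w) \<in> X}
       = curvature_tensors scale"

definition covariant_derivative_curvature_solution ::
  "('k::field \<Rightarrow> 'v::ab_group_add \<Rightarrow> 'v) \<Rightarrow>
   (((nat \<Rightarrow> nat) \<Rightarrow> 'k) \<times> ((nat \<Rightarrow> nat) \<Rightarrow> 'k) set \<times> ((nat \<Rightarrow> nat) \<Rightarrow> 'k) set \<times>
      ('v list \<Rightarrow> 'k) \<times> ('v list \<Rightarrow> 'k)) set \<Rightarrow> bool"
where
  "covariant_derivative_curvature_solution scale X \<longleftrightarrow>
     (\<forall>(a, I, J, U, W)\<in>X.
        a \<in> group_ring 5 \<and>
        minimal_right_ideal 3 I \<and> defines_symmetry_class scale 3 I \<and>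
        minimal_right_ideal 2 J \<and> defines_symmetry_class scale 2 J \<and>
        U \<in> symmetry_class scale 3 I \<and> W \<in> symmetry_class scale 2 J \<and>
        sym_op 5 a (tensor_prod 3 U W) \<noteq> 0) \<and>
     tensor_span {sym_op 5 a (tensor_prod 3 U W) | a I J U W. (a, I, J, U, W) \<in> X}
       = covariant_derivative_curvature_tensors scale"

end

theory Submission
  imports Defs
begin

text \<open>
  A minimal right ideal of \<open>K[S\<^sub>r]\<close> on which a linear character does not vanish is the line spanned by
  that character, so for \<open>r = 3\<close> it is the symmetric line, the skew line or inside the ideal of
  \<open>(2 1)\<close>, where right multiplication by \<open>(y\<^sub>1 + y\<^sub>2) / 3\<close> is the identity (\<open>y\<^sub>1\<close>, \<open>y\<^sub>2\<close> being the two Young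
  symmetrizers).

  The combinations that have to be excluded are those without a component of the shapes \<open>(2 2)\<close> and
  \<open>(3 2)\<close> of the curvature tensors. In place of the Littlewood-Richardson rule, the pigeonhole
  principle is used: whatever way the arguments are distributed over the two factors, two arguments
  in the same row (or column) of a tableau meet in the factor \<open>U\<close>, so the symmetrization over the
  rows (alternation over the columns) kills every product. For a curvature tensor, however, that
  symmetrization vanishes only if the tensor does. For symmetric \<open>U\<close> and skew \<open>W\<close> the alternation
  over the columns alone is not enough: the products that survive it change sign under the exchange
  of the two index pairs.
\<close>

section \<open>Minimal right ideals and linear characters\<close>

abbreviation "perms r \<equiv> {p. p permutes {..<r::nat}}"

section \<open>Convolution formulas in the group ring\<close>

lemma permutes_compose_eq_iff:
  assumes "p permutes S" "q permutes S"
  shows "p \<circ> q = s \<longleftrightarrow> q = inv p \<circ> s" and "p \<circ> q = s \<longleftrightarrow> p = s \<circ> inv q"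
  using permutes_inverses[OF assms(1)] permutes_inverses[OF assms(2)]
  by (auto simp: fun_eq_iff) metis+

lemma gr_mult_outside: "\<not> s permutes {..<r} \<Longrightarrow> gr_mult r a b s = 0"
  unfolding gr_mult_def by (intro sum.neutral ballI) (auto intro: permutes_compose)

lemma gr_mult_left_sum:
  assumes s: "s permutes {..<r}"
  shows "gr_mult r a b s = (\<Sum>p\<in>perms r. a p * b (inv p \<circ> s))"
  unfolding gr_mult_def
proof (rule sum.cong[OF refl])
  fix p assume "p \<in> perms r"
  then have p: "p permutes {..<r}" by simp
  then have "inv p \<circ> s permutes {..<r}"
    by (intro permutes_compose[OF s] permutes_inv)
  moreover have "(\<Sum>q\<in>perms r. if p \<circ> q = s then a p * b q else 0) =
      (\<Sum>q\<in>perms r. if q = inv p \<circ> s then a p * b q else 0)"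
    using permutes_compose_eq_iff(1)[OF p] by (intro sum.cong) auto
  ultimately show "(\<Sum>q\<in>perms r. if p \<circ> q = s then a p * b q else 0) = a p * b (inv p \<circ> s)"
    by (simp add: finite_permutations)
qed

lemma gr_mult_right_sum:
  assumes s: "s permutes {..<r}"
  shows "gr_mult r a b s = (\<Sum>q\<in>perms r. a (s \<circ> inv q) * b q)"
  unfolding gr_mult_def
proof (subst sum.swap, rule sum.cong[OF refl])
  fix q assume "q \<in> perms r"
  then have q: "q permutes {..<r}" by simp
  then have "s \<circ> inv q permutes {..<r}"
    by (intro permutes_compose[OF _ s] permutes_inv)
  moreover have "(\<Sum>p\<in>perms r. if p \<circ> q = s then a p * b q else 0) =
      (\<Sum>p\<in>perms r. if p = s \<circ> inv q then a p * b q else 0)"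
    using permutes_compose_eq_iff(2)[OF _ q] by (intro sum.cong) auto
  ultimately show "(\<Sum>p\<in>perms r. if p \<circ> q = s then a p * b q else 0) = a (s \<circ> inv q) * b q"
    by (simp add: finite_permutations)
qed

text \<open>\<open>right_ideal\<close> does not mention scalars: scaling inside an ideal is right
  multiplication by \<open>c\<close> times the identity permutation. On the left, the same element
  serves as a scalar coefficient of a Young symmetrizer.\<close>

lemma gr_mult_scalar:
  assumes "a \<in> group_ring r"
  shows "gr_mult r a (\<lambda>p. if p = id then c else 0) = (\<lambda>p. c * a p)"
    and "gr_mult r (\<lambda>p. if p = id then c else 0) a = (\<lambda>p. c * a p)"
proof -
  have "gr_mult r a (\<lambda>p. if p = id then c else 0) s = c * a s \<and>
      gr_mult r (\<lambda>p. if p = id then c else 0) a s = c * a s" for s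
  proof (cases "s permutes {..<r}")
    case True
    have "(\<Sum>q\<in>perms r. a (s \<circ> inv q) * (if q = id then c else 0)) =
        (\<Sum>q\<in>perms r. if q = id then c * a s else 0)"
      by (intro sum.cong) auto
    moreover have "(\<Sum>q\<in>perms r. (if q = id then c else 0) * a (inv q \<circ> s)) =
        (\<Sum>q\<in>perms r. if q = id then c * a s else 0)"
      by (intro sum.cong) auto
    ultimately show ?thesis
      using True by (simp add: gr_mult_right_sum[of s r a] gr_mult_left_sum[of s r _ a]
          finite_permutations permutes_id)
  next
    case False
    then show ?thesis
      using assms by (auto simp: gr_mult_outside group_ring_def)
  qed
  then show "gr_mult r a (\<lambda>p. if p = id then c else 0) = (\<lambda>p. c * a p)"
    and "gr_mult r (\<lambda>p. if p = id then c else 0) a = (\<lambda>p. c * a p)" by auto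
qed

text \<open>The axiom \<open>square\<close> is no restriction: a linear character of \<open>S\<^sub>r\<close> is trivial or the sign.\<close>

locale linear_character =
  fixes r :: nat and \<chi> :: "(nat \<Rightarrow> nat) \<Rightarrow> 'k::field"
  assumes mult: "p permutes {..<r} \<Longrightarrow> q permutes {..<r} \<Longrightarrow> \<chi> (p \<circ> q) = \<chi> p * \<chi> q"
    and square: "p permutes {..<r} \<Longrightarrow> \<chi> p * \<chi> p = 1"
begin

text \<open>In characteristic 0 this is r! times the idempotent of the character; no inverse appears
  in the formula because \<chi> takes the same value at \<open>p\<close> and
  \<open>inv p\<close>.\<close>

definition elem :: "(nat \<Rightarrow> nat) \<Rightarrow> 'k" where
  "elem p = (if p permutes {..<r} then \<chi> p else 0)"

definition line :: "((nat \<Rightarrow> nat) \<Rightarrow> 'k) set" where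
  "line = range (\<lambda>c p. c * elem p)"

lemma char_id: "\<chi> id = 1"
  using mult[of id id] square[of id] by (simp add: permutes_id)

lemma char_inv:
  assumes p: "p permutes {..<r}"
  shows "\<chi> (inv p) = \<chi> p"
proof -
  have "\<chi> p * \<chi> (inv p) = \<chi> p * \<chi> p"
    using mult[OF p permutes_inv[OF p]] square[OF p] char_id permutes_inv_o[OF p] by simp
  then have "(\<chi> p * \<chi> p) * \<chi> (inv p) = (\<chi> p * \<chi> p) * \<chi> p" by (simp only: mult.assoc)
  then show ?thesis using square[OF p] by simp
qed

text \<open>Each permutation \<open>p\<close> acts on \<open>elem\<close> as the scalar \<chi>
  \<open>p\<close>, so multiplying by \<open>elem\<close> evaluates the linear extension of \<chi>
  at \<open>a\<close>.\<close>

lemma gr_mult_elem_right: "gr_mult r a elem = (\<lambda>s. (\<Sum>p\<in>perms r. a p * \<chi> p) * elem s)"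
proof
  fix s
  show "gr_mult r a elem s = (\<Sum>p\<in>perms r. a p * \<chi> p) * elem s"
  proof (cases "s permutes {..<r}")
    case True
    then show ?thesis
      by (simp add: gr_mult_left_sum elem_def sum_distrib_right permutes_compose permutes_inv mult
          char_inv mult.assoc)
  qed (simp add: gr_mult_outside elem_def)
qed

lemma gr_mult_elem_left: "gr_mult r elem b = (\<lambda>s. (\<Sum>p\<in>perms r. \<chi> p * b p) * elem s)"
proof
  fix s
  show "gr_mult r elem b s = (\<Sum>p\<in>perms r. \<chi> p * b p) * elem s"
  proof (cases "s permutes {..<r}")
    case True
    then show ?thesis
      by (simp add: gr_mult_right_sum elem_def sum_distrib_left permutes_compose permutes_inv mult
          char_inv mult_ac)
  qed (simp add: gr_mult_outside elem_def)
qed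

lemma right_ideal_line: "right_ideal r line"
proof -
  have "gr_mult r (\<lambda>p. c * elem p) b \<in> line" for b c
  proof -
    have "gr_mult r (\<lambda>p. c * elem p) b = (\<lambda>s. c * gr_mult r elem b s)"
      by (auto simp: gr_mult_def sum_distrib_left fun_eq_iff mult.assoc intro!: sum.cong)
    also have "\<dots> = (\<lambda>s. (c * (\<Sum>p\<in>perms r. \<chi> p * b p)) * elem s)"
      by (simp add: gr_mult_elem_left mult.assoc)
    finally show ?thesis by (auto simp: line_def)
  qed
  moreover have "0 \<in> line" by (auto simp: line_def fun_eq_iff intro!: image_eqI[of _ _ 0])
  moreover have "a + b \<in> line" if "a \<in> line" "b \<in> line" for a b
  proof -
    from that obtain c d where "a = (\<lambda>p. c * elem p)" "b = (\<lambda>p. d * elem p)"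
      by (auto simp: line_def)
    then have "a + b = (\<lambda>p. (c + d) * elem p)" by (simp add: fun_eq_iff distrib_right)
    then show ?thesis by (auto simp: line_def)
  qed
  ultimately show ?thesis
    by (auto simp: right_ideal_def line_def group_ring_def elem_def)
qed

text \<open>If \<chi> is nonzero at some \<open>a\<close> in \<open>I\<close>, then \<open>a\<close>
  times \<open>elem\<close> is a nonzero multiple of \<open>elem\<close> lying in \<open>I\<close>.
  Hence \<open>I\<close> contains the whole line, and minimality gives equality.\<close>

lemma minimal_right_ideal_cases:
  assumes I: "minimal_right_ideal r I"
  obtains "I = line" | "\<And>a. a \<in> I \<Longrightarrow> (\<Sum>p\<in>perms r. a p * \<chi> p) = 0"
proof (cases "\<exists>a\<in>I. (\<Sum>p\<in>perms r. a p * \<chi> p) \<noteq> 0")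
  case True
  then obtain a where a: "a \<in> I" and s: "(\<Sum>p\<in>perms r. a p * \<chi> p) \<noteq> 0" (is "?s \<noteq> 0") by blast
  have ideal: "gr_mult r x b \<in> I" if "x \<in> I" "b \<in> group_ring r" for x b
    using I that by (auto simp: minimal_right_ideal_def right_ideal_def)
  have elem: "elem \<in> group_ring r" by (simp add: elem_def group_ring_def)
  have "(\<lambda>p. c * elem p) \<in> I" for c
  proof -
    have "gr_mult r a elem \<in> I" using a elem by (rule ideal)
    \<comment> \<open>The product \<open>gr_mult r a elem\<close> is \<open>?s\<close> times
      \<open>elem\<close>; this scalar turns it into \<open>c\<close> times
      \<open>elem\<close>.\<close>
    moreover have "(\<lambda>p. if p = id then c / ?s else 0) \<in> group_ring r"
      by (auto simp: group_ring_def permutes_id)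
    ultimately have "gr_mult r (gr_mult r a elem) (\<lambda>p. if p = id then c / ?s else 0) \<in> I"
      by (rule ideal)
    moreover have "gr_mult r a elem \<in> group_ring r"
      by (simp add: group_ring_def gr_mult_outside)
    ultimately show ?thesis
      using s by (simp add: gr_mult_scalar gr_mult_elem_right)
  qed
  then have "line \<subseteq> I" by (auto simp: line_def)
  moreover have "line \<noteq> {0}"
  proof
    assume "line = {0}"
    then have "(\<lambda>p. 1 * elem p) = 0" unfolding line_def by blast
    then have "elem id = 0" by (simp add: fun_eq_iff)
    then show False by (simp add: elem_def permutes_id char_id)
  qed
  ultimately have "I = line"
    using I right_ideal_line by (auto simp: minimal_right_ideal_def)
  then show ?thesis by (rule that)
next
  case False
  then show ?thesis using that by blast
qed

text \<open>Permuting the arguments by \<open>q\<close> replaces \<open>p\<close> by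
  \<open>q \<circ> p\<close> in the sum defining the operator, and the coefficients of
  \<open>elem\<close> absorb this shift up to the factor \<chi> \<open>q\<close>.\<close>

lemma symmetry_class_line:
  assumes I: "I \<subseteq> line" and T: "T \<in> symmetry_class scale r I" and q: "q permutes {..<r}" and "length vs = r"
  shows "T (permute_list q vs) = \<chi> q * T vs"
proof -
  obtain c T' where T': "T = sym_op r (\<lambda>p. c * elem p) T'"
    using I T by (auto simp: symmetry_class_def line_def)
  have "T (permute_list q vs) = (\<Sum>p\<in>perms r. c * \<chi> p * T' (permute_list (q \<circ> p) vs))"
    using \<open>length vs = r\<close> by (simp add: T' sym_op_def elem_def permute_list_compose)
  \<comment> \<open>A factor \<chi> \<open>q\<close> squared, which is 1, is inserted so that every
    summand depends on \<open>q \<circ> p\<close> alone and the sum can be reindexed.\<close>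
  also have "\<dots> = (\<Sum>p\<in>perms r. \<chi> q * (c * \<chi> (q \<circ> p) * T' (permute_list (q \<circ> p) vs)))"
  proof (rule sum.cong[OF refl])
    fix p assume "p \<in> perms r"
    then have "\<chi> (q \<circ> p) = \<chi> q * \<chi> p" by (simp add: mult q)
    moreover have "\<chi> q * (c * (\<chi> q * \<chi> p) * t) = (\<chi> q * \<chi> q) * (c * \<chi> p * t)" for t
      by (simp only: mult_ac)
    ultimately show "c * \<chi> p * T' (permute_list (q \<circ> p) vs) =
        \<chi> q * (c * \<chi> (q \<circ> p) * T' (permute_list (q \<circ> p) vs))"
      using square[OF q] by simp
  qed
  also have "\<dots> = \<chi> q * (\<Sum>p\<in>perms r. c * \<chi> p * T' (permute_list p vs))"
    by (subst setum_permutations_compose_left[OF q, of "\<lambda>p. c * \<chi> p * T' (permute_list p vs)"])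
      (simp add: sum_distrib_left)
  also have "\<dots> = \<chi> q * T vs"
    by (simp add: T' sym_op_def elem_def)
  finally show ?thesis .
qed

end

interpretation trivial: linear_character r "\<lambda>_. 1 :: 'k::field" for r
  by unfold_locales auto

interpretation sign: linear_character r "\<lambda>p. of_int (sign p) :: 'k::field" for r
proof
  fix p q :: "nat \<Rightarrow> nat" assume "p permutes {..<r}" "q permutes {..<r}"
  then show "of_int (sign (p \<circ> q)) = (of_int (sign p) * of_int (sign q) :: 'k)"
    by (metis finite_lessThan of_int_mult permutes_imp_permutation sign_compose)
next
  fix p
  show "of_int (sign p) * of_int (sign p) = (1 :: 'k)"
    by (metis of_int_1 of_int_mult sign_idempotent)
qed

section \<open>Young ideals\<close>

text \<open>In every application below, one left factor shared by all standard tableaux is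
  enough.\<close>

lemma young_idealI:
  assumes "a = (\<Sum>t | standard_tableau \<mu> t. gr_mult (sum_list \<mu>) b (young_symmetrizer t))"
    and "b \<in> group_ring (sum_list \<mu>)"
  shows "a \<in> young_ideal \<mu>"
  unfolding young_ideal_def using assms by (intro CollectI exI[of _ "\<lambda>_. b"]) simp

lemma standard_tableau_row: "standard_tableau [r] t \<longleftrightarrow> t = [[0..<r]]"
proof
  assume "standard_tableau [r] t"
  then obtain row where t: "t = [row]" and row: "set row = {..<r}" "sorted_wrt (<) row"
    by (auto simp: standard_tableau_def length_Suc_conv map_eq_Cons_conv)
  have "row = [0..<r]"
    by (rule strict_sorted_equal) (auto simp: row)
  with t show "t = [[0..<r]]" by simp
qed (auto simp: standard_tableau_def)

lemma trivial_line_belongs_to: "belongs_to (trivial.line r :: ((nat \<Rightarrow> nat) \<Rightarrow> 'k::field) set) [r]"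
proof -
  have row: "row_group [[0..<r]] = perms r"
    using permutes_image[of _ "{..<r}"] by (simp add: row_group_def atLeast0LessThan) blast
  have column: "column [[0..<r]] j = (if j < r then {j} else {})" for j
    by (auto simp: column_def)
  have col: "column_group [[0..<r]] = {id}"
  proof -
    have "q permutes {..<r} \<and> (\<forall>j<r. q j = j) \<longleftrightarrow> q = id" for q
    proof
      assume "q permutes {..<r} \<and> (\<forall>j<r. q j = j)"
      then show "q = id"
        using permutes_not_in[of q "{..<r}"] by (auto simp: fun_eq_iff)
    qed (simp add: permutes_id)
    then show ?thesis
      by (simp add: column_group_def atLeast0LessThan column)
  qed
  have y: "young_symmetrizer [[0..<r]] = (trivial.elem r :: _ \<Rightarrow> 'k)"
    unfolding young_symmetrizer_def row col trivial.elem_def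
    by (intro ext) (simp add: finite_permutations)
  show ?thesis
    unfolding belongs_to_def
  proof
    fix a :: "(nat \<Rightarrow> nat) \<Rightarrow> 'k" assume "a \<in> trivial.line r"
    then obtain c where a: "a = (\<lambda>p. c * trivial.elem r p)" by (auto simp: trivial.line_def)
    have "trivial.elem r \<in> (group_ring r :: ((nat \<Rightarrow> nat) \<Rightarrow> 'k) set)"
      by (simp add: group_ring_def trivial.elem_def)
    then have "a = (\<Sum>t | standard_tableau [r] t.
        gr_mult (sum_list [r]) (\<lambda>p. if p = id then c else 0) (young_symmetrizer t))"
      by (simp add: standard_tableau_row y gr_mult_scalar a)
    moreover have "(\<lambda>p. if p = id then c else 0) \<in> group_ring (sum_list [r])"
      by (auto simp: group_ring_def permutes_id)
    ultimately show "a \<in> young_ideal [r]"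
      by (rule young_idealI)
  qed
qed

lemma sign_line_belongs_to: "belongs_to (sign.line 2 :: ((nat \<Rightarrow> nat) \<Rightarrow> 'k::field) set) [1, 1]"
proof -
  have t: "standard_tableau [1, 1] t \<longleftrightarrow> t = [[0], [1]]" for t
  proof
    assume t: "standard_tableau [1, 1] t"
    then obtain a b where ab: "t = [[a], [b]]"
      by (auto simp: standard_tableau_def length_Suc_conv map_eq_Cons_conv)
    have "\<forall>i j. Suc i < length t \<and> j < length (t ! Suc i) \<longrightarrow> t ! i ! j < t ! Suc i ! j"
      using t unfolding standard_tableau_def by blast
    then have "t ! 0 ! 0 < t ! Suc 0 ! 0"
      using ab by simp
    with t ab have "{a, b} = {..<2}" "a < b"
      by (auto simp: standard_tableau_def numeral_2_eq_2)
    then have "a < b" "b < 2" by auto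
    then show "t = [[0], [1]]" using ab by auto
  qed (auto simp: standard_tableau_def less_Suc_eq numeral_2_eq_2)
  have S: "set (concat [[0], [1]]) = {..<2::nat}" by auto
  have "row_group [[0], [1]] = {id}"
    unfolding row_group_def S by (auto simp: permutes_id fun_eq_iff less_2_cases_iff dest: permutes_not_in)
      (metis One_nat_def lessThan_iff less_2_cases_iff permutes_not_in)
  moreover have "column [[0], [1]] j = (if j = 0 then {..<2} else {})" for j
    by (auto simp: column_def less_Suc_eq conj_disj_distribL conj_disj_distribR ex_disj_distrib
        numeral_2_eq_2)
  then have "column_group [[0], [1]] = perms 2"
    unfolding column_group_def S by (simp add: permutes_image cong: conj_cong)
  ultimately have y: "young_symmetrizer [[0], [1]] = (sign.elem 2 :: _ \<Rightarrow> 'k)"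
    by (intro ext) (simp add: young_symmetrizer_def sign.elem_def finite_permutations)
  show ?thesis
    unfolding belongs_to_def
  proof
    fix a :: "(nat \<Rightarrow> nat) \<Rightarrow> 'k" assume "a \<in> sign.line 2"
    then obtain c where a: "a = (\<lambda>p. c * sign.elem 2 p)" by (auto simp: sign.line_def)
    have "sign.elem 2 \<in> (group_ring 2 :: ((nat \<Rightarrow> nat) \<Rightarrow> 'k) set)"
      by (simp add: group_ring_def sign.elem_def)
    then have "a = (\<Sum>t | standard_tableau [1, 1] t.
        gr_mult (sum_list [1, 1]) (\<lambda>p. if p = id then c else 0) (young_symmetrizer t))"
      using y unfolding t by (simp add: gr_mult_scalar a numeral_2_eq_2)
    moreover have "(\<lambda>p. if p = id then c else 0) \<in> group_ring (sum_list [1, 1])"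
      by (auto simp: group_ring_def permutes_id)
    ultimately show "a \<in> young_ideal [1, 1]"
      by (rule young_idealI)
  qed
qed

text \<open>Besides the identity there is only one transposition; where the trivial character
  vanishes, the two coefficients are opposite, as in \<open>sign.elem\<close>.\<close>

lemma minimal_right_ideal_2:
  assumes I: "minimal_right_ideal 2 (I :: ((nat \<Rightarrow> nat) \<Rightarrow> 'k::field) set)"
  shows "I \<subseteq> trivial.line 2 \<or> I \<subseteq> sign.line 2"
proof (cases rule: trivial.minimal_right_ideal_cases[OF I])
  case 2
  have perms: "perms 2 = {id, transpose 0 1}"
  proof -
    have "{..<2} = {0, 1::nat}" by auto
    then show ?thesis using permutes_doubleton_iff[of _ 0 "1::nat"] by auto
  qed
  have ne: "id \<noteq> transpose 0 (1::nat)"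
    by (metis transpose_eq_id_iff zero_neq_one)
  have "I \<subseteq> sign.line 2"
  proof
    fix a assume a: "a \<in> I"
    then have "a \<in> group_ring 2"
      using I by (auto simp: minimal_right_ideal_def right_ideal_def)
    moreover have "a (transpose 0 1) = - a id"
      using 2[OF a] ne by (simp add: perms eq_neg_iff_add_eq_0 add.commute)
    ultimately have "a p = a id * sign.elem 2 p" for p
      using perms ne by (cases "p permutes {..<2}")
        (auto simp: sign.elem_def group_ring_def sign_swap_id set_eq_iff[of "perms 2"])
    then have "a = (\<lambda>p. a id * sign.elem 2 p)" ..
    then show "a \<in> sign.line 2" by (auto simp: sign.line_def)
  qed
  then show ?thesis ..
qed simp

section \<open>Shape (2 1) and the minimal right ideals of K[S_3]\<close>

lemma standard_tableau_hook:
  "{t. standard_tableau [2, 1] t} = {[[0, 1], [2]], [[0, 2], [1]]}"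
proof -
  have "t = [[0, 1], [2]] \<or> t = [[0, 2], [1]]" if t: "standard_tableau [2, 1] t" for t
  proof -
    obtain a b c where abc: "t = [[a, b], [c]]"
      using t by (auto simp: standard_tableau_def length_Suc_conv map_eq_Cons_conv numeral_2_eq_2)
    have "\<forall>i j. Suc i < length t \<and> j < length (t ! Suc i) \<longrightarrow> t ! i ! j < t ! Suc i ! j"
      using t unfolding standard_tableau_def by blast
    then have "t ! 0 ! 0 < t ! Suc 0 ! 0"
      using abc by simp
    moreover have "a < b" "distinct [a, b, c]" "{a, b, c} = {..<3}"
      using t abc by (auto simp: standard_tableau_def numeral_3_eq_3)
    moreover have "a < 3" "b < 3" "c < 3"
      using calculation(4) by auto
    ultimately have "a = 0 \<and> (b = 1 \<and> c = 2 \<or> b = 2 \<and> c = 1)"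
      using abc by simp presburger
    then show ?thesis using abc by auto
  qed
  moreover have "standard_tableau [2, 1] [[0, 1], [2]]" "standard_tableau [2, 1] [[0, 2], [1]]"
    by (auto simp: standard_tableau_def less_Suc_eq)
  ultimately show ?thesis by blast
qed

text \<open>Transposing the tableau exchanges \<open>b\<close> and \<open>c\<close>, so both groups
  are instances of one stabilizer computation.\<close>

lemma hook_groups:
  assumes "distinct [a, b, c]"
  shows "row_group [[a, b], [c]] = {id, transpose a b}"
    and "column_group [[a, b], [c]] = {id, transpose a c}"
proof -
  have stabilizer: "{p. p permutes {a, b, c} \<and> p ` {a, b} = {a, b} \<and> p ` {c} = {c}} = {id, transpose a b}"
    if "distinct [a, b, c]" for a b c :: nat
  proof -
    have "p permutes {a, b, c} \<and> p ` {a, b} = {a, b} \<and> p ` {c} = {c} \<longleftrightarrow> p permutes {a, b}" for p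
    proof
      assume "p permutes {a, b, c} \<and> p ` {a, b} = {a, b} \<and> p ` {c} = {c}"
      then show "p permutes {a, b}"
        by (auto intro: permutes_superset)
    next
      assume p: "p permutes {a, b}"
      then have "p c = c" using that permutes_not_in by fastforce
      then show "p permutes {a, b, c} \<and> p ` {a, b} = {a, b} \<and> p ` {c} = {c}"
        using permutes_image[OF p] permutes_subset[OF p, of "{a, b, c}"] by auto
    qed
    then show ?thesis by (auto simp: permutes_doubleton_iff)
  qed
  show "row_group [[a, b], [c]] = {id, transpose a b}"
    using stabilizer[OF assms] by (simp add: row_group_def)
  have "column [[a, b], [c]] j = (if j = 0 then {a, c} else if j = 1 then {b} else {})" for j
    by (auto simp: column_def less_Suc_eq conj_disj_distribL conj_disj_distribR ex_disj_distrib)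
  then have "column_group [[a, b], [c]] =
      {p. p permutes {a, c, b} \<and> p ` {a, c} = {a, c} \<and> p ` {b} = {b}}"
    by (auto simp: column_group_def insert_commute)
  then show "column_group [[a, b], [c]] = {id, transpose a c}"
    using stabilizer[of a c b] assms by simp
qed

text \<open>The symmetrizer is (1 + (a b))(1 - (a c)). Right multiplication evaluates
  \<open>x\<close> at \<open>s \<circ> inv q\<close>, which reverses the product of the two
  transpositions in the last term.\<close>

lemma gr_mult_young_symmetrizer_hook:
  assumes abc: "distinct [a, b, c]" "{a, b, c} = {..<3}" and s: "s permutes {..<3}"
  shows "gr_mult 3 x (young_symmetrizer [[a, b], [c]]) s =
    x s + x (s \<circ> transpose a b) - x (s \<circ> transpose a c) - x (s \<circ> transpose a c \<circ> transpose a b)"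
proof -
  let ?y = "young_symmetrizer [[a, b], [c]]"
  have ne: "transpose a b \<noteq> id" "transpose a c \<noteq> id"
    using abc by (auto simp: transpose_eq_id_iff)
  have *: "transpose a b \<circ> transpose a c permutes {..<3}" "transpose a b permutes {..<3}"
    "transpose a c permutes {..<3}" "id permutes {..<3::nat}"
    using abc by (auto intro!: permutes_compose permutes_swap_id permutes_id)
  have y: "?y q = (if q = id then 1 else 0) + (if q = transpose a b then 1 else 0) -
      (if q = transpose a c then 1 else 0) - (if q = transpose a b \<circ> transpose a c then 1 else 0)" for q
    using ne abc by (auto simp: young_symmetrizer_def hook_groups sign_swap_id)
  have "inv (transpose a b \<circ> transpose a c) = transpose a c \<circ> transpose a b"
    by (simp add: o_inv_distrib)
  then have "x (s \<circ> inv q) * ?y q =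
      (if q = id then x s else 0) + (if q = transpose a b then x (s \<circ> transpose a b) else 0) -
      (if q = transpose a c then x (s \<circ> transpose a c) else 0) -
      (if q = transpose a b \<circ> transpose a c then x (s \<circ> transpose a c \<circ> transpose a b) else 0)" for q
    unfolding y distrib_left right_diff_distrib
    by (intro arg_cong2[of _ _ _ _ "(+)"] arg_cong2[of _ _ _ _ "(-)"]) (auto simp: comp_assoc)
  then show ?thesis
    using * by (simp add: gr_mult_right_sum[OF s] sum.distrib sum_subtractf finite_permutations)
qed

lemma sum_perms_3:
  "(\<Sum>p\<in>perms 3. f p) = f id + f (transpose 0 1) + f (transpose 0 2) + f (transpose 1 2) +
    f (transpose 0 1 \<circ> transpose 0 2) + f (transpose 0 2 \<circ> transpose 0 1)"
proof -
  have S: "{..<3} = insert 0 (insert 1 {2::nat})" by auto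
  have f: "finite {1, 2::nat}" "0 \<notin> {1, 2::nat}" "finite {2::nat}" "1 \<notin> {2::nat}" by auto
  have "transpose 0 1 \<circ> transpose 1 2 = transpose 0 2 \<circ> transpose 0 (1::nat)"
    "transpose 0 2 \<circ> transpose 1 2 = transpose 0 1 \<circ> transpose 0 (2::nat)"
    by (auto simp: fun_eq_iff transpose_def)
  then show ?thesis
    unfolding S sum_over_permutations_insert[OF f(1,2)] sum_over_permutations_insert[OF f(3,4)]
    by (simp add: add_ac)
qed

text \<open>The two conditions together make the coefficients of \<open>x\<close> sum to zero over
  each left coset of the alternating group. In the sum of the two Young symmetrizers the
  transpositions cancel, leaving twice the identity minus both 3-cycles, and this multiplies such an
  \<open>x\<close> by 3.\<close>

lemma belongs_to_hook:
  assumes I: "I \<subseteq> group_ring 3"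
    and trivial: "\<And>x. x \<in> I \<Longrightarrow> (\<Sum>p\<in>perms 3. x p) = (0 :: 'k::field_char_0)"
    and sign: "\<And>x. x \<in> I \<Longrightarrow> (\<Sum>p\<in>perms 3. x p * of_int (sign p)) = 0"
  shows "belongs_to I [2, 1]"
  unfolding belongs_to_def
proof
  fix x assume x: "x \<in> I"
  define b where "b = (\<lambda>p. x p / 3)"
  have "x s = gr_mult 3 b (young_symmetrizer [[0, 1], [2]]) s +
      gr_mult 3 b (young_symmetrizer [[0, 2], [1]]) s" for s
  proof (cases "s permutes {..<3}")
    case True
    let ?c = "s \<circ> transpose 0 2 \<circ> transpose 0 1" and ?d = "s \<circ> transpose 0 1 \<circ> transpose 0 2"
    have "(\<Sum>p\<in>perms 3. x (s \<circ> p)) = 0"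
      using trivial[OF x] setum_permutations_compose_left[OF True, of x] by simp
    moreover have square: "of_int (sign s) * of_int (sign s) = (1 :: 'k)"
      by (rule sign.square[OF True])
    have "(\<Sum>p\<in>perms 3. x (s \<circ> p) * of_int (sign p)) =
        of_int (sign s) * (\<Sum>p\<in>perms 3. x (s \<circ> p) * of_int (sign (s \<circ> p)))"
      unfolding sum_distrib_left
    proof (rule sum.cong[OF refl])
      fix p assume "p \<in> perms 3"
      then have "of_int (sign (s \<circ> p)) = (of_int (sign s) * of_int (sign p) :: 'k)"
        using sign.mult[OF True, of p] by simp
      then show "x (s \<circ> p) * of_int (sign p) =
          of_int (sign s) * (x (s \<circ> p) * of_int (sign (s \<circ> p)))"
        using square by algebra
    qed
    then have "(\<Sum>p\<in>perms 3. x (s \<circ> p) * of_int (sign p)) = 0"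
      using sign[OF x]
        setum_permutations_compose_left[OF True, of "\<lambda>p. x p * of_int (sign p)"] by simp
    \<comment> \<open>The weight 1 + sign removes the transpositions and doubles the even
      permutations.\<close>
    ultimately have "(\<Sum>p\<in>perms 3. x (s \<circ> p) * (1 + of_int (sign p))) = 0"
      by (simp add: distrib_left sum.distrib)
    then have "2 * (x s + x ?c + x ?d) = 0"
      by (simp add: sum_perms_3 sign_swap_id sign_compose permutation_swap_id comp_assoc algebra_simps)
    then have zero: "x s + x ?c + x ?d = 0"
      by (simp only: mult_eq_0_iff) simp
    have "{0, 1, 2} = {..<3::nat}" "{0, 2, 1} = {..<3::nat}" by auto
    then have "gr_mult 3 b (young_symmetrizer [[0, 1], [2]]) s +
        gr_mult 3 b (young_symmetrizer [[0, 2], [1]]) s = 2 * b s - b ?c - b ?d"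
      using True by (simp add: gr_mult_young_symmetrizer_hook)
    also have "\<dots> = (2 * x s - x ?c - x ?d) / 3"
      by (simp add: b_def diff_divide_distrib)
    also have "2 * x s - x ?c - x ?d = 3 * x s"
      using zero by algebra
    finally show ?thesis by simp
  next
    case False
    then show ?thesis using I x by (auto simp: gr_mult_outside group_ring_def)
  qed
  then have "x = (\<Sum>t | standard_tableau [2, 1] t. gr_mult (sum_list [2, 1]) b (young_symmetrizer t))"
    unfolding standard_tableau_hook by (intro ext) simp
  moreover have "b \<in> group_ring (sum_list [2, 1])"
    using I x by (auto simp: b_def group_ring_def)
  ultimately show "x \<in> young_ideal [2, 1]"
    by (rule young_idealI)
qed

lemma symmetric_tensor_trivial_class:
  "I \<subseteq> trivial.line r \<Longrightarrow> T \<in> symmetry_class scale r I \<Longrightarrow> symmetric_tensor r T"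
  using trivial.symmetry_class_line[of I r T scale] by (simp add: symmetric_tensor_def)

lemma skew_tensor_sign_class:
  "I \<subseteq> sign.line r \<Longrightarrow> T \<in> symmetry_class scale r I \<Longrightarrow> skew_tensor r T"
  using sign.symmetry_class_line[of I r T scale] by (simp add: skew_tensor_def)

lemma minimal_right_ideal_3:
  assumes I: "minimal_right_ideal 3 (I :: ((nat \<Rightarrow> nat) \<Rightarrow> 'k::field_char_0) set)"
  shows "I \<subseteq> trivial.line 3 \<or> I \<subseteq> sign.line 3 \<or> belongs_to I [2, 1]"
proof (cases rule: trivial.minimal_right_ideal_cases[OF I])
  case trivial: 2
  show ?thesis
  proof (cases rule: sign.minimal_right_ideal_cases[OF I])
    case sign: 2
    have "I \<subseteq> group_ring 3"
      using I by (simp add: minimal_right_ideal_def right_ideal_def)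
    then have "belongs_to I [2, 1]"
      using trivial sign by (intro belongs_to_hook) auto
    then show ?thesis by blast
  qed simp
qed simp

lemma belongs_to_mono: "I \<subseteq> J \<Longrightarrow> belongs_to J \<mu> \<Longrightarrow> belongs_to I \<mu>"
  by (auto simp: belongs_to_def)

section \<open>Exchanging arguments of products\<close>

text \<open>The argument at position \<open>i\<close> of \<open>vs\<close> sits in slot
  \<open>inv p i\<close> of \<open>permute_list p vs\<close>, so conjugation by \<open>p\<close>
  turns an exchange of arguments into an exchange of slots.\<close>

lemma permute_list_swap:
  assumes p: "p permutes {..<length vs}" and "i < length vs" "j < length vs"
  shows "permute_list p (permute_list (transpose i j) vs) =
    permute_list (transpose (inv p i) (inv p j)) (permute_list p vs)"
proof -
  have inv_p: "inv p i < length vs" "inv p j < length vs"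
    using permutes_in_image[OF permutes_inv[OF p]] assms by auto
  have "transpose i j \<circ> p = p \<circ> transpose (inv p i) (inv p j)"
    using permutes_inverses[OF p] by (auto simp: fun_eq_iff transpose_def) 
  then show ?thesis
    using p inv_p
    by (metis length_permute_list lessThan_iff permute_list_compose permutes_swap_id)
qed

lemma take_permute_list:
  assumes "q permutes {..<n}" "n \<le> length vs"
  shows "take n (permute_list q vs) = permute_list q (take n vs)"
  using assms permutes_in_image[OF assms(1)]
  by (intro nth_equalityI) (auto simp: permute_list_def)

lemma drop_permute_list:
  assumes "q permutes {..<n}"
  shows "drop n (permute_list q vs) = drop n vs"
  using permutes_not_in[OF assms]
  by (intro nth_equalityI) (auto simp: permute_list_def)

text \<open>Treats symmetric factors (\<epsilon> = 1) and skew factors (\<epsilon> = -1) alike. The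
  case i = j must be left out, since \<epsilon> = -1 would otherwise force \<open>T\<close> to
  vanish on lists of length \<open>r\<close> in characteristic 0.\<close>

definition swap_invariant :: "nat \<Rightarrow> 'k::field \<Rightarrow> ('v list \<Rightarrow> 'k) \<Rightarrow> bool" where
  "swap_invariant r \<epsilon> T \<longleftrightarrow>
     (\<forall>i<r. \<forall>j<r. i \<noteq> j \<longrightarrow> (\<forall>vs. length vs = r \<longrightarrow> T (permute_list (transpose i j) vs) = \<epsilon> * T vs))"

lemma swap_invariant_symmetric: "symmetric_tensor r T \<Longrightarrow> swap_invariant r 1 T"
  by (simp add: swap_invariant_def symmetric_tensor_def permutes_swap_id)

lemma swap_invariant_skew: "skew_tensor r T \<Longrightarrow> swap_invariant r (-1) T"
  by (simp add: swap_invariant_def skew_tensor_def permutes_swap_id sign_swap_id)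

text \<open>Both arguments have landed in slots of \<open>U\<close>, so the exchange leaves the
  other factor untouched. The list \<open>us\<close> is a separate variable so that explicit
  argument lists can be supplied.\<close>

lemma tensor_prod_swap_left:
  assumes U: "swap_invariant 3 \<epsilon> U" and p: "p permutes {..<n}" and n: "length vs = n" "3 \<le> n"
    and ij: "i < n" "j < n" "i \<noteq> j" "inv p i < 3" "inv p j < 3"
    and us: "us = permute_list (transpose i j) vs"
  shows "tensor_prod 3 U W (permute_list p us) = \<epsilon> * tensor_prod 3 U W (permute_list p vs)"
proof -
  let ?q = "transpose (inv p i) (inv p j)"
  have q: "?q permutes {..<3}"
    using ij by (intro permutes_swap_id) auto
  have "inv p i \<noteq> inv p j"
    using permutes_inverses[OF p] \<open>i \<noteq> j\<close> by metis
  moreover have "p permutes {..<length vs}"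
    using p n by simp
  ultimately show ?thesis
    using n ij U
    by (simp add: us permute_list_swap tensor_prod_def take_permute_list[OF q]
        drop_permute_list[OF q] swap_invariant_def)
qed

lemma tensor_prod_swap_right:
  assumes W: "swap_invariant 2 \<epsilon> W" and p: "p permutes {..<5}" and vs: "length vs = 5"
    and ij: "i < 5" "j < 5" "i \<noteq> j" "\<not> inv p i < 3" "\<not> inv p j < 3"
    and us: "us = permute_list (transpose i j) vs"
  shows "tensor_prod 3 U W (permute_list p us) = \<epsilon> * tensor_prod 3 U W (permute_list p vs)"
proof -
  have ne: "inv p i \<noteq> inv p j"
    using permutes_inverses[OF p] \<open>i \<noteq> j\<close> by metis
  have "inv p i < 5" "inv p j < 5"
    using permutes_in_image[OF permutes_inv[OF p]] ij by auto
  \<comment> \<open>\<open>W\<close> has just the slots 3 and 4, so two distinct arguments outside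
    \<open>U\<close> occupy exactly these.\<close>
  with ij ne have "inv p i = 3 \<and> inv p j = 4 \<or> inv p i = 4 \<and> inv p j = 3" by linarith
  then have q: "transpose (inv p i) (inv p j) = transpose 3 4"
    by (auto simp: transpose_commute)
  define xs where "xs = permute_list p vs"
  have len: "length xs = 5" using vs by (simp add: xs_def)
  have "take 3 (permute_list (transpose 3 4) xs) = take 3 xs"
    using len by (intro nth_equalityI) (auto simp: permute_list_def)
  moreover have "drop 3 (permute_list (transpose 3 4) xs) = permute_list (transpose 0 1) (drop 3 xs)"
    using len by (intro nth_equalityI) (auto simp: permute_list_def transpose_def)
  ultimately have "tensor_prod 3 U W (permute_list (transpose 3 4) xs) = \<epsilon> * tensor_prod 3 U W xs"
    using W len by (simp add: tensor_prod_def swap_invariant_def)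
  then show ?thesis
    using p vs ij by (simp add: us permute_list_swap q xs_def)
qed

section \<open>Counting the arguments that fall to \<open>U\<close>\<close>

lemma sum_slots:
  fixes p :: "nat \<Rightarrow> nat"
  assumes p: "p permutes {..<n}" and "3 \<le> n"
  shows "(\<Sum>i<n. of_bool (inv p i < 3)) = (3::nat)"
proof -
  have "(\<Sum>i<n. of_bool (inv p i < 3)) = (\<Sum>i<n. of_bool (i < 3) :: nat)"
    using sum.permute[OF permutes_inv[OF p], of "\<lambda>i. of_bool (i < 3) :: nat"] by (simp add: o_def)
  also have "\<dots> = (\<Sum>i<(3::nat). 1)"
    using \<open>3 \<le> n\<close> by (intro sum.mono_neutral_cong_right) auto
  finally show ?thesis by simp
qed


text \<open>Interchanging the two sums shows that cancellation for each rearrangement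
  \<open>p\<close> separately is enough, whatever the coefficients of \<open>a\<close> are. All
  exclusions below rest on this.\<close>

lemma sym_op_combination_zero:
  fixes T :: "'v list \<Rightarrow> 'k::field"
  assumes R: "R = sym_op r a T"
    and zero: "\<And>p. p permutes {..<r} \<Longrightarrow> (\<Sum>(c, vs)\<leftarrow>xs. c * T (permute_list p vs)) = 0"
  shows "(\<Sum>(c, vs)\<leftarrow>xs. c * R vs) = 0"
proof -
  have "(\<Sum>(c, vs)\<leftarrow>xs. c * R vs) =
    (\<Sum>p | p permutes {..<r}. a p * (\<Sum>(c, vs)\<leftarrow>xs. c * T (permute_list p vs)))"
    unfolding R sym_op_def
    by (induction xs)
      (auto simp: sum.distrib[symmetric] sum_distrib_left algebra_simps intro!: sum.cong)
  also have "\<dots> = 0" using zero by (intro sum.neutral) simp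
  finally show ?thesis .
qed

text \<open>Only one argument falls outside \<open>U\<close>, so of two disjoint pairs one lies
  entirely in \<open>U\<close>. The first pairing consists of the columns, the second of the rows,
  of the tableau with rows {0, 2} and {1, 3}.\<close>

lemma slots_4:
  assumes p: "p permutes {..<4}"
  shows "inv p 0 < 3 \<and> inv p 1 < 3 \<or> inv p 2 < 3 \<and> inv p 3 < (3::nat)"
    and "inv p 0 < 3 \<and> inv p 2 < 3 \<or> inv p 1 < 3 \<and> inv p 3 < (3::nat)"
proof -
  have "(\<Sum>i<4. f i) = f 0 + f 1 + f 2 + f 3" for f :: "nat \<Rightarrow> nat"
    by (simp add: eval_nat_numeral)
  then have *: "of_bool (inv p 0 < 3) + of_bool (inv p 1 < 3) + of_bool (inv p 2 < 3) +
      of_bool (inv p 3 < 3) = (3::nat)"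
    using sum_slots[OF p] by simp
  show "inv p 0 < 3 \<and> inv p 1 < 3 \<or> inv p 2 < 3 \<and> inv p 3 < (3::nat)"
    and "inv p 0 < 3 \<and> inv p 2 < 3 \<or> inv p 1 < 3 \<and> inv p 3 < (3::nat)"
    using * by (cases "inv p 0 < 3"; cases "inv p 1 < 3"; cases "inv p 2 < 3"; cases "inv p 3 < 3"; simp)+
qed

lemma slots_5:
  fixes p :: "nat \<Rightarrow> nat"
  assumes p: "p permutes {..<5}"
  shows "of_bool (inv p 0 < 3) + of_bool (inv p 1 < 3) + of_bool (inv p 2 < 3) +
      of_bool (inv p 3 < 3) + of_bool (inv p 4 < 3) = (3::nat)"
proof -
  have "(\<Sum>i<5. f i) = f 0 + f 1 + f 2 + f 3 + f 4" for f :: "nat \<Rightarrow> nat"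
    by (simp add: eval_nat_numeral)
  then show ?thesis
    using sum_slots[OF p] by simp
qed

section \<open>Excluded factors\<close>

text \<open>Alternating over the columns {0, 1} and {2, 3} annihilates every product, but multiplies
  a tensor with the curvature skewness by 4.\<close>

lemma curvature_symmetric_factor:
  fixes U :: "'v list \<Rightarrow> 'k::field_char_0"
  assumes U: "swap_invariant 3 1 U"
    and R: "R = sym_op 4 a (tensor_prod 3 U w)"
    and skew: "\<And>i j k l. R [i, j, k, l] = - R [j, i, k, l]" "\<And>i j k l. R [i, j, k, l] = R [k, l, i, j]"
  shows "R [i, j, k, l] = 0"
proof -
  let ?xs = "[(1, [i, j, k, l]), (-1, [j, i, k, l]), (-1, [i, j, l, k]), (1, [j, i, l, k])]"
  have "(\<Sum>(c, vs)\<leftarrow>?xs. c * tensor_prod 3 U w (permute_list p vs)) = 0"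
    if p: "p permutes {..<4}" for p
  proof -
    note swap = tensor_prod_swap_left[OF U p, where W = w]
    from slots_4(1)[OF p] show ?thesis
    proof
      assume "inv p 0 < 3 \<and> inv p 1 < 3"
      then show ?thesis
        using swap[of "[i, j, k, l]" 0 1 "[j, i, k, l]"] swap[of "[i, j, l, k]" 0 1 "[j, i, l, k]"]
        by (simp add: permute_list_def[of "transpose _ _"] transpose_def)
    next
      assume "inv p 2 < 3 \<and> inv p 3 < 3"
      then show ?thesis
        using swap[of "[i, j, k, l]" 2 3 "[i, j, l, k]"] swap[of "[j, i, k, l]" 2 3 "[j, i, l, k]"]
        by (simp add: permute_list_def[of "transpose _ _"] transpose_def)
    qed
  qed
  from sym_op_combination_zero[OF R this]
  have "R [i, j, k, l] - R [j, i, k, l] - R [i, j, l, k] + R [j, i, l, k] = 0"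
    by (simp add: algebra_simps)
  also have "R [i, j, k, l] - R [j, i, k, l] - R [i, j, l, k] + R [j, i, l, k] = 4 * R [i, j, k, l]"
    using skew(1)[of i j k l] skew(1)[of i j l k] skew(1)[of k l i j] skew(2)[of i j k l]
      skew(2)[of i j l k] by simp
  finally show ?thesis by simp
qed

text \<open>Together with skewness in the last pair, \<open>zero\<close> makes the three terms of
  the Bianchi identity equal.\<close>

lemma curvature_zero_if_row_symmetrization_zero:
  fixes R :: "'v list \<Rightarrow> 'k::field_char_0"
  assumes skew: "\<And>i j k l. R [i, j, k, l] = - R [j, i, k, l]"
    and pair: "\<And>i j k l. R [i, j, k, l] = R [k, l, i, j]"
    and bianchi: "\<And>i j k l. R [i, j, k, l] + R [i, k, l, j] + R [i, l, j, k] = 0"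
    and zero: "\<And>i j k l. R [i, j, k, l] + R [i, l, k, j] = 0"
  shows "R [i, j, k, l] = 0"
proof -
  have s: "R [i, j, k, l] = - R [i, j, l, k]" for i j k l
    using skew[of k l i j] pair by metis
  have "R [i, l, j, k] = R [i, j, k, l]" "R [i, k, l, j] = R [i, j, k, l]"
    using zero[of i j k l] zero[of i j l k] s[of i l j k] s[of i j k l]
    by (simp_all add: add_eq_0_iff)
  then have "3 * R [i, j, k, l] = 0"
    using bianchi[of i j k l] by simp
  then show ?thesis by simp
qed

lemma curvature_skew_factor:
  fixes U :: "'v list \<Rightarrow> 'k::field_char_0"
  assumes U: "swap_invariant 3 (-1) U"
    and R: "R = sym_op 4 a (tensor_prod 3 U w)"
    and skew: "\<And>i j k l. R [i, j, k, l] = - R [j, i, k, l]"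
    and pair: "\<And>i j k l. R [i, j, k, l] = R [k, l, i, j]"
    and bianchi: "\<And>i j k l. R [i, j, k, l] + R [i, k, l, j] + R [i, l, j, k] = 0"
  shows "R [i, j, k, l] = 0"
proof (rule curvature_zero_if_row_symmetrization_zero[where R = R, OF skew pair bianchi])
  fix i j k l :: 'v
  \<comment> \<open>Symmetrization over the rows {0, 2} and {1, 3}; by pair symmetry its four terms
    are two terms counted twice.\<close>
  let ?xs = "[(1, [i, j, k, l]), (1, [k, j, i, l]), (1, [i, l, k, j]), (1, [k, l, i, j])]"
  have "(\<Sum>(c, vs)\<leftarrow>?xs. c * tensor_prod 3 U w (permute_list p vs)) = 0"
    if p: "p permutes {..<4}" for p
  proof -
    note swap = tensor_prod_swap_left[OF U p, where W = w]
    from slots_4(2)[OF p] show ?thesis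
    proof
      assume "inv p 0 < 3 \<and> inv p 2 < 3"
      then show ?thesis
        using swap[of "[i, j, k, l]" 0 2 "[k, j, i, l]"] swap[of "[i, l, k, j]" 0 2 "[k, l, i, j]"]
        by (simp add: permute_list_def[of "transpose _ _"] transpose_def)
    next
      assume "inv p 1 < 3 \<and> inv p 3 < 3"
      then show ?thesis
        using swap[of "[i, j, k, l]" 1 3 "[i, l, k, j]"] swap[of "[k, j, i, l]" 1 3 "[k, l, i, j]"]
        by (simp add: permute_list_def[of "transpose _ _"] transpose_def)
    qed
  qed
  from sym_op_combination_zero[OF R this]
  have "R [i, j, k, l] + R [k, j, i, l] + R [i, l, k, j] + R [k, l, i, j] = 0"
    by (simp add: add.assoc)
  then have "2 * (R [i, j, k, l] + R [i, l, k, j]) = 0"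
    using pair[of i j k l] pair[of k j i l] by algebra
  then show "R [i, j, k, l] + R [i, l, k, j] = 0" by (simp only: mult_eq_0_iff) simp
qed

text \<open>Symmetrizing over the rows {0, 2, 4} and {1, 3} of a tableau of shape (3 2) gives a
  cyclic identity for \<open>G\<close>, the symmetrization over {1, 3} alone. The second Bianchi
  identity then forces \<open>G\<close> to vanish, which reduces the claim to the case of order
  4.\<close>

lemma derivative_curvature_skew_factor:
  fixes U :: "'v list \<Rightarrow> 'k::field_char_0"
  assumes U: "swap_invariant 3 (-1) U"
    and R: "R = sym_op 5 a (tensor_prod 3 U W)"
    and skew: "\<And>i j k l m. R [i, j, k, l, m] = - R [j, i, k, l, m]"
    and pair: "\<And>i j k l m. R [i, j, k, l, m] = R [k, l, i, j, m]"
    and bianchi1: "\<And>i j k l m. R [i, j, k, l, m] + R [i, k, l, j, m] + R [i, l, j, k, m] = 0"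
    and bianchi2: "\<And>i j k l m. R [i, j, k, l, m] + R [i, j, l, m, k] + R [i, j, m, k, l] = 0"
  shows "R [i, j, k, l, m] = 0"
proof -
  define G where "G i k j l m = R [i, j, k, l, m] + R [i, l, k, j, m]" for i k j l m
  have skew': "R [i, j, k, l, m] = - R [i, j, l, k, m]" for i j k l m
    using skew[of k l i j m] pair by metis
  have G_swap: "G k i j l m = G i k j l m" "G i k l j m = G i k j l m" for i j k l m
    using pair[of i j k l m] pair[of i l k j m] by (simp_all add: G_def)
  have cyclic: "G i k j l m + G k m j l i + G m i j l k = 0" for i j k l m
  proof -
    \<comment> \<open>All twelve elements of the row group, applied to one argument list.\<close>
    let ?xs = "[(1, [i, j, k, l, m]), (1, [k, j, i, l, m]), (1, [i, l, k, j, m]), (1, [k, l, i, j, m]),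
      (1, [k, j, m, l, i]), (1, [m, j, k, l, i]), (1, [k, l, m, j, i]), (1, [m, l, k, j, i]),
      (1, [m, j, i, l, k]), (1, [i, j, m, l, k]), (1, [m, l, i, j, k]), (1, [i, l, m, j, k])]"
    define f where "f p vs = tensor_prod 3 U W (permute_list p vs)" for p vs
    have "(\<Sum>(c, vs)\<leftarrow>?xs. c * f p vs) = 0" if p: "p permutes {..<5}" for p
    proof -
      note swap = tensor_prod_swap_left[OF U p, where W = W, folded f_def]
      \<comment> \<open>If at most one argument of the row {0, 2, 4} is in \<open>U\<close>, the
        other two slots of \<open>U\<close> take the whole row {1, 3}. In each case the twelve terms
        cancel in six pairs.\<close>
      consider "inv p 0 < 3 \<and> inv p 2 < 3" | "inv p 0 < 3 \<and> inv p 4 < 3" |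
          "inv p 2 < 3 \<and> inv p 4 < 3" | "inv p 1 < 3 \<and> inv p 3 < 3"
        using slots_5[OF p]
        by (cases "inv p 0 < 3"; cases "inv p 1 < 3"; cases "inv p 2 < 3"; cases "inv p 3 < 3";
            cases "inv p 4 < 3"; simp)
      then show ?thesis
      proof cases
        case 1
        then have sw: "f p [y, u, x, v, z] = - f p [x, u, y, v, z]" for x y z u v
          using swap[of "[x, u, y, v, z]" 0 2 "[y, u, x, v, z]"]
          by (simp add: permute_list_def[of "transpose _ _"] transpose_def)
        show ?thesis
          using sw[of k j i l m] sw[of m j k l i] sw[of i j m l k]
            sw[of k l i j m] sw[of m l k j i] sw[of i l m j k] by simp
      next
        case 2
        then have sw: "f p [z, u, y, v, x] = - f p [x, u, y, v, z]" for x y z u v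
          using swap[of "[x, u, y, v, z]" 0 4 "[z, u, y, v, x]"]
          by (simp add: permute_list_def[of "transpose _ _"] transpose_def)
        show ?thesis
          using sw[of k j i l m] sw[of m j k l i] sw[of i j m l k]
            sw[of k l i j m] sw[of m l k j i] sw[of i l m j k] by simp
      next
        case 3
        then have sw: "f p [x, u, z, v, y] = - f p [x, u, y, v, z]" for x y z u v
          using swap[of "[x, u, y, v, z]" 2 4 "[x, u, z, v, y]"]
          by (simp add: permute_list_def[of "transpose _ _"] transpose_def)
        show ?thesis
          using sw[of k j i l m] sw[of m j k l i] sw[of i j m l k]
            sw[of k l i j m] sw[of m l k j i] sw[of i l m j k] by simp
      next
        case 4
        then have sw: "f p [x, v, y, u, z] = - f p [x, u, y, v, z]" for x y z u v
          using swap[of "[x, u, y, v, z]" 1 3 "[x, v, y, u, z]"]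
          by (simp add: permute_list_def[of "transpose _ _"] transpose_def)
        show ?thesis
          using sw[of i j k l m] sw[of k j i l m] sw[of k j m l i] sw[of m j k l i]
            sw[of m j i l k] sw[of i j m l k] by simp
      qed
    qed
    from sym_op_combination_zero[OF R this[unfolded f_def]]
    have "G i k j l m + G k i j l m + G k m j l i + G m k j l i + G m i j l k + G i m j l k = 0"
      by (simp add: G_def algebra_simps)
    then have "2 * (G i k j l m + G k m j l i + G m i j l k) = 0"
      using G_swap(1)[of k i j l m] G_swap(1)[of m k j l i] G_swap(1)[of i m j l k]
      by (simp add: algebra_simps)
    then show ?thesis by (simp only: mult_eq_0_iff) simp
  qed
  have G_zero: "G i k j l m = 0" for i j k l m
  proof -
    \<comment> \<open>The second Bianchi identity compares the derivative arguments \<open>m\<close>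
      and \<open>k\<close>; the difference has \<open>l\<close> or \<open>j\<close> in the last
      place.\<close>
    have second: "G i k j l m - G i m j l k = R [i, j, k, m, l] + R [i, l, k, m, j]" for i j k l m
      using bianchi2[of i j k l m] bianchi2[of i l k j m] skew'[of i j l m k] skew'[of i l j m k]
        skew'[of i j m k l] skew'[of i l m k j]
      by (simp add: G_def algebra_simps)
    have three: "3 * G i k j l m =
      R [i, j, k, m, l] + R [i, l, k, m, j] + R [k, j, i, m, l] + R [k, l, i, m, j]" for i j k l m
    proof -
      have "G m i j l k = G i k j l m - (R [i, j, k, m, l] + R [i, l, k, m, j])"
        using second[of i k j l m] G_swap(1)[of i m j l k] by (simp add: algebra_simps)
      moreover have "G k m j l i = G i k j l m - (R [k, j, i, m, l] + R [k, l, i, m, j])"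
        using second[of k i j l m] G_swap(1)[of i k j l m] by (simp add: algebra_simps)
      ultimately show ?thesis
        using cyclic[of i k j l m] by algebra
    qed
    \<comment> \<open>The six terms cancel in pairs by skewness in the first two arguments.\<close>
    have alternating: "G a x b c y + G b x a c y + G c x b a y = 0" for a x b c y
      using skew[of a b x c y] skew[of a c x b y] skew[of b c x a y]
      by (simp add: G_def)
    \<comment> \<open>Summing \<open>cyclic\<close> over the three ways to place \<open>j\<close>, \<open>l\<close>, \<open>m\<close> cancels all terms except those that
      are symmetric in \<open>i\<close>, \<open>k\<close>; it is the polarization of setting \<open>j = l = m\<close>.\<close>
    have "G i k j l m + G i k m l j + G i k j m l = 0"
      using cyclic[of m i j l k] cyclic[of j i m l k] cyclic[of l i j m k]
        alternating[of m i j l k] alternating[of m k j l i]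
        G_swap(1)[of m k j l i] G_swap(1)[of j k m l i] G_swap(1)[of l k j m i]
      by algebra
    \<comment> \<open>By pair symmetry the four terms of \<open>three\<close> regroup into
      \<open>G\<close> with \<open>j\<close> or \<open>l\<close> as derivative argument.\<close>
    moreover have "G i k m l j + G i k j m l = 3 * G i k j l m"
      using three[of i k j l m] pair[of k j i m l] pair[of k l i m j] by (simp add: G_def)
    ultimately have "4 * G i k j l m = 0" by (simp add: add.assoc)
    then show ?thesis by simp
  qed
  \<comment> \<open>With the derivative argument frozen, the identities of order 4 hold and the
    vanishing of \<open>G\<close> is the missing hypothesis \<open>zero\<close>.\<close>
  define R' where "R' vs = R (vs @ [m])" for vs
  have "R' [i, j, k, l] = 0"
  proof (rule curvature_zero_if_row_symmetrization_zero)
    fix i j k l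
    show "R' [i, j, k, l] = - R' [j, i, k, l]" by (simp only: R'_def append.simps) (rule skew)
    show "R' [i, j, k, l] = R' [k, l, i, j]" by (simp only: R'_def append.simps) (rule pair)
    show "R' [i, j, k, l] + R' [i, k, l, j] + R' [i, l, j, k] = 0"
      by (simp only: R'_def append.simps) (rule bianchi1)
    show "R' [i, j, k, l] + R' [i, l, k, j] = 0"
      using G_zero[of i k j l m] by (simp add: R'_def G_def)
  qed
  then show ?thesis by (simp add: R'_def)
qed

text \<open>A product survives the column alternation only if one argument of each index pair falls
  to \<open>W\<close>. Exchanging these two in \<open>W\<close> and their two partners in
  \<open>U\<close> then gives the sign -1, so adding the terms with the pairs exchanged cancels
  everything. On \<open>R\<close> this combination is multiplication by 8: four alternations times
  two orders of the pairs.\<close>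

lemma derivative_curvature_symmetric_skew_factors:
  fixes U :: "'v list \<Rightarrow> 'k::field_char_0"
  assumes U: "swap_invariant 3 1 U" and W: "swap_invariant 2 (-1) W"
    and R: "R = sym_op 5 a (tensor_prod 3 U W)"
    and skew: "\<And>i j k l m. R [i, j, k, l, m] = - R [j, i, k, l, m]"
    and pair: "\<And>i j k l m. R [i, j, k, l, m] = R [k, l, i, j, m]"
  shows "R [i, j, k, l, m] = 0"
proof -
  let ?xs = "[(1, [i, j, k, l, m]), (-1, [j, i, k, l, m]), (-1, [i, j, l, k, m]), (1, [j, i, l, k, m]),
    (1, [k, l, i, j, m]), (-1, [k, l, j, i, m]), (-1, [l, k, i, j, m]), (1, [l, k, j, i, m])]"
  define f where "f p vs = tensor_prod 3 U W (permute_list p vs)" for p vs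
  have "(\<Sum>(c, vs)\<leftarrow>?xs. c * f p vs) = 0" if p: "p permutes {..<5}" for p
  proof -
    note swap = tensor_prod_swap_left[OF U p, where W = W, folded f_def]
      and swap' = tensor_prod_swap_right[OF W p, where U = U, folded f_def]
    consider "inv p 0 < 3 \<and> inv p 1 < 3" | "inv p 2 < 3 \<and> inv p 3 < 3" |
        "inv p 0 < 3 \<and> inv p 2 < 3 \<and> \<not> inv p 1 < 3 \<and> \<not> inv p 3 < 3" |
        "inv p 1 < 3 \<and> inv p 3 < 3 \<and> \<not> inv p 0 < 3 \<and> \<not> inv p 2 < 3" |
        "inv p 0 < 3 \<and> inv p 3 < 3 \<and> \<not> inv p 1 < 3 \<and> \<not> inv p 2 < 3" |
        "inv p 1 < 3 \<and> inv p 2 < 3 \<and> \<not> inv p 0 < 3 \<and> \<not> inv p 3 < 3"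
      using slots_5[OF p]
      by (cases "inv p 0 < 3"; cases "inv p 1 < 3"; cases "inv p 2 < 3"; cases "inv p 3 < 3";
          cases "inv p 4 < 3"; simp)
    then show ?thesis
    proof cases
      case 1
      then have sw: "f p [y, x, u, v, z] = f p [x, y, u, v, z]" for x y z u v
        using swap[of "[x, y, u, v, z]" 0 1 "[y, x, u, v, z]"]
        by (simp add: permute_list_def[of "transpose _ _"] transpose_def)
      show ?thesis
        using sw[of j i k l m] sw[of j i l k m] sw[of l k i j m] sw[of l k j i m] by simp
    next
      case 2
      then have sw: "f p [x, y, v, u, z] = f p [x, y, u, v, z]" for x y z u v
        using swap[of "[x, y, u, v, z]" 2 3 "[x, y, v, u, z]"]
        by (simp add: permute_list_def[of "transpose _ _"] transpose_def)
      show ?thesis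
        using sw[of i j l k m] sw[of j i l k m] sw[of k l j i m] sw[of l k j i m] by simp
    next
      case 3
      then have sw: "f p [u, v, x, y, z] = - f p [x, y, u, v, z]" for x y z u v
        using swap[of "[x, y, u, v, z]" 0 2 "[u, y, x, v, z]"]
          swap'[of "[u, y, x, v, z]" 1 3 "[u, v, x, y, z]"]
        by (simp add: permute_list_def[of "transpose _ _"] transpose_def)
      show ?thesis
        using sw[of i j k l m] sw[of j i k l m] sw[of i j l k m] sw[of j i l k m] by simp
    next
      case 4
      then have sw: "f p [u, v, x, y, z] = - f p [x, y, u, v, z]" for x y z u v
        using swap[of "[x, y, u, v, z]" 1 3 "[x, v, u, y, z]"]
          swap'[of "[x, v, u, y, z]" 0 2 "[u, v, x, y, z]"]
        by (simp add: permute_list_def[of "transpose _ _"] transpose_def)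
      show ?thesis
        using sw[of i j k l m] sw[of j i k l m] sw[of i j l k m] sw[of j i l k m] by simp
    next
      case 5
      then have sw: "f p [v, u, y, x, z] = - f p [x, y, u, v, z]" for x y z u v
        using swap[of "[x, y, u, v, z]" 0 3 "[v, y, u, x, z]"]
          swap'[of "[v, y, u, x, z]" 1 2 "[v, u, y, x, z]"]
        by (simp add: permute_list_def[of "transpose _ _"] transpose_def)
      show ?thesis
        using sw[of i j k l m] sw[of j i k l m] sw[of i j l k m] sw[of j i l k m] by simp
    next
      case 6
      then have sw: "f p [v, u, y, x, z] = - f p [x, y, u, v, z]" for x y z u v
        using swap[of "[x, y, u, v, z]" 1 2 "[x, u, y, v, z]"]
          swap'[of "[x, u, y, v, z]" 0 3 "[v, u, y, x, z]"]
        by (simp add: permute_list_def[of "transpose _ _"] transpose_def)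
      show ?thesis
        using sw[of i j k l m] sw[of j i k l m] sw[of i j l k m] sw[of j i l k m] by simp
    qed
  qed
  from sym_op_combination_zero[OF R this[unfolded f_def]]
  have "R [i, j, k, l, m] - R [j, i, k, l, m] - R [i, j, l, k, m] + R [j, i, l, k, m] +
    R [k, l, i, j, m] - R [k, l, j, i, m] - R [l, k, i, j, m] + R [l, k, j, i, m] = 0"
    by (simp add: algebra_simps)
  then have "8 * R [i, j, k, l, m] = 0"
    using skew[of j i k l m] skew[of j i l k m] skew[of l k i j m] skew[of l k j i m]
      pair[of i j k l m] pair[of i j l k m] pair[of j i k l m] pair[of j i l k m]
    by algebra
  then show ?thesis by simp
qed

section \<open>Generators of the curvature tensors\<close>

text \<open>Gives access to the library facts on \<open>module.span\<close>, here that every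
  generator lies in the span.\<close>

lemma module_functions: "module (\<lambda>(c :: 'k::field) (T :: 'v list \<Rightarrow> 'k) vs. c * T vs)"
  by unfold_locales (auto simp: fun_eq_iff algebra_simps)

text \<open>Tensors are 0 on lists of any other length, so the values on four arguments
  decide.\<close>

lemma curvature_tensor_eq_zero:
  assumes "R \<in> curvature_tensors scale" "\<And>i j k l. R [i, j, k, l] = 0"
  shows "R = 0"
proof
  fix vs
  show "R vs = 0 vs"
  proof (cases "length vs = 4")
    case True
    then obtain i j k l where "vs = [i, j, k, l]"
      by (auto simp: length_Suc_conv eval_nat_numeral)
    then show ?thesis using assms by simp
  next
    case False
    then show ?thesis
      using assms by (simp add: curvature_tensors_def tensors_def)
  qed
qed

lemma covariant_derivative_curvature_tensor_eq_zero:
  assumes "R \<in> covariant_derivative_curvature_tensors scale" "\<And>i j k l m. R [i, j, k, l, m] = 0"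
  shows "R = 0"
proof
  fix vs
  show "R vs = 0 vs"
  proof (cases "length vs = 5")
    case True
    then obtain i j k l m where "vs = [i, j, k, l, m]"
      by (auto simp: length_Suc_conv eval_nat_numeral)
    then show ?thesis using assms by simp
  next
    case False
    then show ?thesis
      using assms by (simp add: covariant_derivative_curvature_tensors_def tensors_def)
  qed
qed

text \<open>Each generator lies in the span and is therefore itself a curvature tensor. As it is
  nonzero, the exclusion lemmas rule out both character lines for \<open>I\<close>.\<close>

lemma curvature_solution_belongs_to:
  fixes scale :: "'k::field_char_0 \<Rightarrow> 'v::ab_group_add \<Rightarrow> 'v"
  assumes X: "curvature_solution scale X" and mem: "(a, I, U, w) \<in> X"
  shows "belongs_to I [2, 1]"
proof -
  define R where "R = sym_op 4 a (tensor_prod 3 U w)"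
  have I: "minimal_right_ideal 3 I" and U: "U \<in> symmetry_class scale 3 I" and "R \<noteq> 0"
    using X mem by (auto simp: curvature_solution_def R_def)
  have "R \<in> tensor_span {sym_op 4 a (tensor_prod 3 U w) | a I U w. (a, I, U, w) \<in> X}"
    using mem by (intro module.span_base[OF module_functions]) (auto simp: R_def)
  then have R: "R \<in> curvature_tensors scale"
    using X by (simp add: curvature_solution_def)
  then have skew: "R [i, j, k, l] = - R [j, i, k, l]" and pair: "R [i, j, k, l] = R [k, l, i, j]"
    and bianchi: "R [i, j, k, l] + R [i, k, l, j] + R [i, l, j, k] = 0" for i j k l
    unfolding curvature_tensors_def by blast+
  have "\<not> I \<subseteq> trivial.line 3"
  proof
    assume "I \<subseteq> trivial.line 3"
    then have "swap_invariant 3 1 U"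
      using U by (intro swap_invariant_symmetric symmetric_tensor_trivial_class)
    from curvature_symmetric_factor[OF this R_def skew pair] curvature_tensor_eq_zero[OF R]
    show False using \<open>R \<noteq> 0\<close> by blast
  qed
  moreover have "\<not> I \<subseteq> sign.line 3"
  proof
    assume "I \<subseteq> sign.line 3"
    then have "swap_invariant 3 (-1) U"
      using U by (intro swap_invariant_skew skew_tensor_sign_class)
    from curvature_skew_factor[OF this R_def skew pair bianchi] curvature_tensor_eq_zero[OF R]
    show False using \<open>R \<noteq> 0\<close> by blast
  qed
  ultimately show ?thesis
    using minimal_right_ideal_3[OF I] by blast
qed

text \<open>Three possibilities for \<open>I\<close> and two for \<open>J\<close> give six
  combinations. Skew \<open>U\<close> removes two of them and symmetric \<open>U\<close> with skew
  \<open>W\<close> a third; the remaining three are the alternatives of the claim.\<close>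

lemma covariant_derivative_curvature_solution_belongs_to:
  fixes scale :: "'k::field_char_0 \<Rightarrow> 'v::ab_group_add \<Rightarrow> 'v"
  assumes X: "covariant_derivative_curvature_solution scale X" and mem: "(a, I, J, U, W) \<in> X"
  shows "belongs_to I [3] \<and> belongs_to J [2] \<and> symmetric_tensor 3 U \<and> symmetric_tensor 2 W \<or>
    belongs_to I [2, 1] \<and> belongs_to J [2] \<and> symmetric_tensor 2 W \<or>
    belongs_to I [2, 1] \<and> belongs_to J [1, 1] \<and> skew_tensor 2 W"
proof -
  define R where "R = sym_op 5 a (tensor_prod 3 U W)"
  have I: "minimal_right_ideal 3 I" and U: "U \<in> symmetry_class scale 3 I"
    and J: "minimal_right_ideal 2 J" and W: "W \<in> symmetry_class scale 2 J" and "R \<noteq> 0"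
    using X mem by (auto simp: covariant_derivative_curvature_solution_def R_def)
  have "R \<in> tensor_span {sym_op 5 a (tensor_prod 3 U W) | a I J U W. (a, I, J, U, W) \<in> X}"
    unfolding R_def using mem by (intro module.span_base[OF module_functions]) blast
  then have R: "R \<in> covariant_derivative_curvature_tensors scale"
    using X by (simp add: covariant_derivative_curvature_solution_def)
  then have skew: "R [i, j, k, l, m] = - R [j, i, k, l, m]"
    and pair: "R [i, j, k, l, m] = R [k, l, i, j, m]"
    and bianchi1: "R [i, j, k, l, m] + R [i, k, l, j, m] + R [i, l, j, k, m] = 0"
    and bianchi2: "R [i, j, k, l, m] + R [i, j, l, m, k] + R [i, j, m, k, l] = 0" for i j k l m
    unfolding covariant_derivative_curvature_tensors_def by blast+
  have U_not_skew: "\<not> I \<subseteq> sign.line 3"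
  proof
    assume "I \<subseteq> sign.line 3"
    then have "swap_invariant 3 (-1) U"
      using U by (intro swap_invariant_skew skew_tensor_sign_class)
    from derivative_curvature_skew_factor[OF this R_def skew pair bianchi1 bianchi2]
      covariant_derivative_curvature_tensor_eq_zero[OF R]
    show False using \<open>R \<noteq> 0\<close> by blast
  qed
  have not_both: "\<not> (I \<subseteq> trivial.line 3 \<and> J \<subseteq> sign.line 2)"
  proof
    assume *: "I \<subseteq> trivial.line 3 \<and> J \<subseteq> sign.line 2"
    then have "swap_invariant 3 1 U"
      using U by (intro swap_invariant_symmetric symmetric_tensor_trivial_class) auto
    moreover have "swap_invariant 2 (-1) W"
      using W * by (intro swap_invariant_skew skew_tensor_sign_class) auto
    ultimately have "R [i, j, k, l, m] = 0" for i j k l m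
      by (rule derivative_curvature_symmetric_skew_factors[OF _ _ R_def skew pair])
    then show False
      using covariant_derivative_curvature_tensor_eq_zero[OF R] \<open>R \<noteq> 0\<close> by blast
  qed
  have sym_U: "belongs_to I [3] \<and> symmetric_tensor 3 U" if "I \<subseteq> trivial.line 3"
    using that U by (blast intro: belongs_to_mono trivial_line_belongs_to symmetric_tensor_trivial_class)
  have sym_W: "belongs_to J [2] \<and> symmetric_tensor 2 W" if "J \<subseteq> trivial.line 2"
    using that W by (blast intro: belongs_to_mono trivial_line_belongs_to symmetric_tensor_trivial_class)
  have skew_W: "belongs_to J [1, 1] \<and> skew_tensor 2 W" if "J \<subseteq> sign.line 2"
    using that W by (blast intro: belongs_to_mono sign_line_belongs_to skew_tensor_sign_class)
  show ?thesis
    using minimal_right_ideal_3[OF I] minimal_right_ideal_2[OF J] U_not_skew not_both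
      sym_U sym_W skew_W by blast
qed

theorem theorem9:
  fixes scale :: "'k::real_normed_field \<Rightarrow> 'v::ab_group_add \<Rightarrow> 'v"
  assumes "finite_dimensional_vector_space scale B"
  shows "(\<forall>X. curvature_solution scale X \<longrightarrow>
            (\<forall>(a, I, U, w)\<in>X. belongs_to I [2, 1])) \<and>
         (\<forall>X. covariant_derivative_curvature_solution scale X \<longrightarrow>
            (\<forall>(a, I, J, U, W)\<in>X.
               belongs_to I [3] \<and> belongs_to J [2] \<and> symmetric_tensor 3 U \<and> symmetric_tensor 2 W \<or>
               belongs_to I [2, 1] \<and> belongs_to J [2] \<and> symmetric_tensor 2 W \<or>
               belongs_to I [2, 1] \<and> belongs_to J [1, 1] \<and> skew_tensor 2 W))"
proof (intro conjI allI impI)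
  fix X assume "curvature_solution scale X"
  then show "\<forall>(a, I, U, w)\<in>X. belongs_to I [2, 1]"
    using curvature_solution_belongs_to by blast
next
  fix X assume "covariant_derivative_curvature_solution scale X"
  then show "\<forall>(a, I, J, U, W)\<in>X.
      belongs_to I [3] \<and> belongs_to J [2] \<and> symmetric_tensor 3 U \<and> symmetric_tensor 2 W \<or>
      belongs_to I [2, 1] \<and> belongs_to J [2] \<and> symmetric_tensor 2 W \<or>
      belongs_to I [2, 1] \<and> belongs_to J [1, 1] \<and> skew_tensor 2 W"
    using covariant_derivative_curvature_solution_belongs_to by blast
qed

end
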